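(* Let $\Sigma=\{\alpha_1,\alpha_2,\dots\}$ be an infinite countable alphabet, $\upsilon\notin\Sigma$ a variable, $\vec k=(k_n)_{n\in\mathbb N}\subseteq\mathbb N$ an increasing sequence, $\vec w\in L^\infty(\Sigma,\vec k;\upsilon)$ and $r,s\in\mathbb N$. If $L(\Sigma,\vec k;\upsilon)=A_1\cup\dots\cup A_r$ and $L(\Sigma,\vec k)=C_1\cup\dots\cup C_s$, then there exist an extraction $\vec u\prec\vec w$ and $1\le i_0\le r$, $1\le j_0\le s$ such that $EV(\vec u)\subseteq A_{i_0}$ and $E(\vec u)\subseteq C_{j_0}$.
   Context: $\mathbb N=\{1,2,\dots\}$. $L(\Sigma,\vec k)$ is the set of functions $w$ from a nonempty finite $\mathrm{dom}(w)\subseteq\mathbb N$ into $\Sigma$ with $w(n)\in\{\alpha_1,\dots,\alpha_{k_n}\}$ for all $n\in\mathrm{dom}(w)$; $L(\Sigma,\vec k;\upsilon)$ is the set of functions $w$ from a nonempty finite $\mathrm{dom}(w)\subseteq\mathbb N$ into $\Sigma\cup\{\upsilon\}$ with $w(n)\in\{\upsilon,\alpha_1,\dots,\alpha_{k_n}\}$ for all $n$ and $w(n)=\upsilon$ for some $n$. $w<u$ means $\max\mathrm{dom}(w)<\min\mathrm{dom}(u)$, and then $w\star u$ is the word on $\mathrm{dom}(w)\cup\mathrm{dom}(u)$ agreeing with $w$ and $u$ on their domains. $T_0(w)=w$; for $p\in\mathbb N$, $T_p(w)$ has domain $\mathrm{dom}(w)$ and replaces each $\upsilon$ at position $n$ by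 $\alpha_p$ if $k_n\ge p$ and by $\alpha_{k_n}$ if $k_n<p$, leaving letters of $\Sigma$ unchanged. $L^\infty(\Sigma,\vec k;\upsilon)$ is the set of sequences $\vec w=(w_n)_{n\in\mathbb N}$ in $L(\Sigma,\vec k;\upsilon)$ with $w_n<w_{n+1}$ for all $n$. For such $\vec w$, $EV(\vec w)$ is the set of all words $T_{p_1}(w_{n_1})\star\cdots\star T_{p_\lambda}(w_{n_\lambda})$ with $\lambda\in\mathbb N$, $n_1<\dots<n_\lambda$, $0\le p_i\le k_{n_i}$ integers and $0\in\{p_1,\dots,p_\lambda\}$; $E(\vec w)$ is the set of such words with $1\le p_i\le k_{n_i}$ for all $i$. $\vec u\prec\vec w$ means $\vec u\in L^\infty(\Sigma,\vec k;\upsilon)$ and every term of $\vec u$ lies in $EV(\vec w)$. *)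

theory Defs
  imports Main
begin

text \<open>
  The alphabet \<open>\<Sigma>\<close> is given by its enumeration \<open>\<alpha>\<close>: \<open>\<Sigma> = \<alpha> ` {1..}\<close>. Positive integers are
  rendered as natural numbers \<open>\<ge> 1\<close>: the values at \<open>0\<close> of \<open>\<alpha>\<close>, of \<open>k\<close> and of a sequence of
  words are never used. A located word is a partial function from positions to symbols.
\<close>

type_synonym 'a lword = "nat \<rightharpoonup> 'a"

definition const_words :: "(nat \<Rightarrow> 'a) \<Rightarrow> (nat \<Rightarrow> nat) \<Rightarrow> 'a lword set" where
  "const_words \<alpha> k =
    {w. finite (dom w) \<and> dom w \<noteq> {} \<and> dom w \<subseteq> {1..} \<and>
        (\<forall>n\<in>dom w. the (w n) \<in> \<alpha> ` {1..k n})}"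

definition var_words :: "(nat \<Rightarrow> 'a) \<Rightarrow> 'a \<Rightarrow> (nat \<Rightarrow> nat) \<Rightarrow> 'a lword set" where
  "var_words \<alpha> \<upsilon> k =
    {w. finite (dom w) \<and> dom w \<noteq> {} \<and> dom w \<subseteq> {1..} \<and>
        (\<forall>n\<in>dom w. the (w n) \<in> insert \<upsilon> (\<alpha> ` {1..k n})) \<and>
        (\<exists>n\<in>dom w. w n = Some \<upsilon>)}"

definition word_less :: "'a lword \<Rightarrow> 'a lword \<Rightarrow> bool" where
  "word_less w u \<longleftrightarrow> Max (dom w) < Min (dom u)"

text \<open>
  \<open>w \<star> u\<close> is \<open>w ++ u\<close>; it is only formed for \<open>w < u\<close>, where the domains are disjoint. The empty
  map is only the neutral element of the fold below; it is not a word.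
\<close>

definition star_list :: "'a lword list \<Rightarrow> 'a lword" where
  "star_list ws = foldr (++) ws Map.empty"

definition subst :: "(nat \<Rightarrow> 'a) \<Rightarrow> 'a \<Rightarrow> (nat \<Rightarrow> nat) \<Rightarrow> nat \<Rightarrow> 'a lword \<Rightarrow> 'a lword" where
  "subst \<alpha> \<upsilon> k p w =
    (if p = 0 then w
     else (\<lambda>n. map_option
            (\<lambda>a. if a = \<upsilon> then (if k n \<ge> p then \<alpha> p else \<alpha> (k n)) else a) (w n)))"

definition word_seqs :: "(nat \<Rightarrow> 'a) \<Rightarrow> 'a \<Rightarrow> (nat \<Rightarrow> nat) \<Rightarrow> (nat \<Rightarrow> 'a lword) set" where
  "word_seqs \<alpha> \<upsilon> k =
    {w. \<forall>n\<ge>1. w n \<in> var_words \<alpha> \<upsilon> k \<and> word_less (w n) (w (Suc n))}"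

definition EV :: "(nat \<Rightarrow> 'a) \<Rightarrow> 'a \<Rightarrow> (nat \<Rightarrow> nat) \<Rightarrow> (nat \<Rightarrow> 'a lword) \<Rightarrow> 'a lword set" where
  "EV \<alpha> \<upsilon> k w =
    {star_list (map (\<lambda>i. subst \<alpha> \<upsilon> k (p i) (w (n i))) [1..<Suc l]) | l n p.
       l \<ge> 1 \<and> strict_mono_on {1..l} n \<and>
       (\<forall>i\<in>{1..l}. n i \<ge> 1 \<and> p i \<le> k (n i)) \<and> (\<exists>i\<in>{1..l}. p i = 0)}"

definition E :: "(nat \<Rightarrow> 'a) \<Rightarrow> 'a \<Rightarrow> (nat \<Rightarrow> nat) \<Rightarrow> (nat \<Rightarrow> 'a lword) \<Rightarrow> 'a lword set" where
  "E \<alpha> \<upsilon> k w =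
    {star_list (map (\<lambda>i. subst \<alpha> \<upsilon> k (p i) (w (n i))) [1..<Suc l]) | l n p.
       l \<ge> 1 \<and> strict_mono_on {1..l} n \<and>
       (\<forall>i\<in>{1..l}. n i \<ge> 1 \<and> 1 \<le> p i \<and> p i \<le> k (n i))}"

definition extraction ::
    "(nat \<Rightarrow> 'a) \<Rightarrow> 'a \<Rightarrow> (nat \<Rightarrow> nat) \<Rightarrow> (nat \<Rightarrow> 'a lword) \<Rightarrow> (nat \<Rightarrow> 'a lword) \<Rightarrow> bool" where
  "extraction \<alpha> \<upsilon> k u w \<longleftrightarrow>
    u \<in> word_seqs \<alpha> \<upsilon> k \<and> (\<forall>n\<ge>1. u n \<in> EV \<alpha> \<upsilon> k w)"

end

theory Submission
  imports Defs "HOL-Analysis.Function_Topology"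
begin

text \<open>
  An extraction of \<open>w\<close> is encoded by index words: located words over the alphabet \<open>1, 2, \<dots>\<close> with
  variable \<open>0\<close>, where the letter \<open>p\<close> at position \<open>n\<close> stands for \<open>T\<^sub>p(w\<^sub>n)\<close>. Since \<open>++\<close> is a total associative
  operation, the ultrafilters on index words form a compact right topological semigroup. There is an
  idempotent \<open>p\<close> in a minimal left ideal of the ultrafilters that concentrate on constant words far
  to the right, and below it an idempotent \<open>q\<close> concentrating on variable words far to the right. For
  every \<open>a \<ge> 1\<close> the image of \<open>q\<close> under the homomorphism \<open>T\<^sub>a\<close> is then an idempotent below \<open>p\<close>, so it
  equals \<open>p\<close>, simultaneously for infinitely many \<open>a\<close>. Pulling the colourings back to index words
  and picking a colour class in \<open>q\<close> and one in \<open>p\<close>, the usual Galvin-Glazer construction chooses the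
  terms of \<open>u\<close> one after another, with all products and substitution instances remaining in the two
  classes.
\<close>

subsection \<open>Idempotents in compact right topological semigroups\<close>

text \<open>Distinct functions differ at some \<open>i\<close>, and evaluation at \<open>i\<close>
  is continuous. The instance lets function spaces carry the semigroup below, where compact sets
  have to be closed.\<close>

instance "fun" :: (type, t2_space) t2_space
proof
  fix f g :: "'a \<Rightarrow> 'b"
  assume "f \<noteq> g"
  then obtain i where "f i \<noteq> g i" by auto
  then obtain U V where UV: "open U" "open V" "f i \<in> U" "g i \<in> V" "U \<inter> V = {}"
    using hausdorff by metis
  have "open ((\<lambda>h. h i) -` W)" if "open W" for W :: "'b set"
  proof -
    have "continuous_on UNIV (\<lambda>h :: 'a \<Rightarrow> 'b. h i)" by simp
    then show ?thesis using that by (rule open_vimage[rotated])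
  qed
  then show "\<exists>U V. open U \<and> open V \<and> f \<in> U \<and> g \<in> V \<and> U \<inter> V = {}"
    using UV by (intro exI[of _ "(\<lambda>h. h i) -` U"] exI[of _ "(\<lambda>h. h i) -` V"]) auto
qed

lemma compact_UNIV_fun:
  assumes "compact (UNIV :: 'b::topological_space set)"
  shows "compact (UNIV :: ('a \<Rightarrow> 'b) set)"
proof -
  have "compact_space (product_topology (\<lambda>i::'a. (euclidean :: 'b topology)) UNIV)"
    unfolding compact_space_product_topology using assms by (simp add: compact_space_def)
  then show ?thesis
    by (simp add: euclidean_product_topology compact_space_def)
qed

text \<open>Zorn's lemma yields maximal elements, so it is applied to complements. A chain has the
  finite intersection property inside the compact \<open>K\<close>, hence a nonempty compact
  intersection. \<open>P\<close> is kept abstract to serve both subsemigroups and left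
  ideals.\<close>

lemma compact_minimal_subset:
  fixes K :: "'b::t2_space set"
  assumes "P K"
    and compact: "\<And>M. P M \<Longrightarrow> compact M \<and> M \<noteq> {}"
    and Inter: "\<And>\<C>. \<C> \<noteq> {} \<Longrightarrow> (\<And>M. M \<in> \<C> \<Longrightarrow> P M) \<Longrightarrow> compact (\<Inter>\<C>) \<Longrightarrow> \<Inter>\<C> \<noteq> {} \<Longrightarrow> P (\<Inter>\<C>)"
  obtains M where "P M" "M \<subseteq> K" "\<And>N. P N \<Longrightarrow> N \<subseteq> M \<Longrightarrow> N = M"
proof -
  have "\<exists>M\<in>uminus ` {M. P M \<and> M \<subseteq> K}. \<forall>X\<in>uminus ` {M. P M \<and> M \<subseteq> K}. M \<subseteq> X \<longrightarrow> X = M"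
  proof (rule subset_Zorn_nonempty)
    show "uminus ` {M. P M \<and> M \<subseteq> K} \<noteq> {}"
      using \<open>P K\<close> by auto
  next
    fix \<C> assume ne: "\<C> \<noteq> {}" and "subset.chain (uminus ` {M. P M \<and> M \<subseteq> K}) \<C>"
    then have sub: "\<C> \<subseteq> uminus ` {M. P M \<and> M \<subseteq> K}"
      and chain: "\<And>X Y. X \<in> \<C> \<Longrightarrow> Y \<in> \<C> \<Longrightarrow> X \<subseteq> Y \<or> Y \<subseteq> X"
      by (auto simp: subset_chain_def)
    define \<D> where "\<D> = uminus ` \<C>"
    have \<D>: "P M \<and> M \<subseteq> K" if "M \<in> \<D>" for M
      using sub that unfolding \<D>_def by auto
    have chainD: "X \<subseteq> Y \<or> Y \<subseteq> X" if "X \<in> \<D>" "Y \<in> \<D>" for X Y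
      using chain that unfolding \<D>_def by blast
    have neD: "\<D> \<noteq> {}" using ne by (simp add: \<D>_def)
    have cl: "closed M" if "M \<in> \<D>" for M
      using \<D> compact compact_imp_closed that by blast
    have "K \<inter> \<Inter>\<D> \<noteq> {}"
    proof (rule compact_imp_fip)
      show "compact K" using \<open>P K\<close> compact by blast
      show "closed T" if "T \<in> \<D>" for T using cl that by blast
      fix F assume F: "finite F" "F \<subseteq> \<D>"
      show "K \<inter> \<Inter>F \<noteq> {}"
      proof (cases "F = {}")
        case True
        then show ?thesis using \<open>P K\<close> compact by auto
      next
        case False
        from F(1) False F(2) have "\<Inter>F \<in> F"
        proof (induction F rule: finite_ne_induct)
          case (insert x F)
          then have "\<Inter>F \<in> F" by simp
          then have "x \<subseteq> \<Inter>F \<or> \<Inter>F \<subseteq> x"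
            using chainD insert.prems by (meson insertI1 insertI2 subsetD)
          then have "\<Inter>(insert x F) = x \<or> \<Inter>(insert x F) = \<Inter>F"
            by (metis Inter_insert inf.absorb1 inf.absorb2)
          then show ?case using \<open>\<Inter>F \<in> F\<close> by (metis insertI1 insertI2)
        qed auto
        then have "\<Inter>F \<in> \<D>" using F by blast
        then show ?thesis using \<D> compact by (metis inf.absorb2)
      qed
    qed
    moreover have "compact (\<Inter>\<D>)"
    proof -
      have "closed (\<Inter>\<D>)" using cl by (intro closed_Inter ballI)
      moreover have "\<Inter>\<D> \<subseteq> K" using neD \<D> by blast
      ultimately show ?thesis
        using \<open>P K\<close> compact compact_Int_closed by (metis inf.absorb_iff2)
    qed
    ultimately have "P (\<Inter>\<D>)"
      using Inter[OF neD] \<D> by blast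
    moreover have "\<Inter>\<D> \<subseteq> K" using neD \<D> by blast
    moreover have "\<Union>\<C> = - \<Inter>\<D>" by (auto simp: \<D>_def)
    ultimately show "\<Union>\<C> \<in> uminus ` {M. P M \<and> M \<subseteq> K}" by blast
  qed
  then obtain M where M: "P M" "M \<subseteq> K"
    and max: "\<forall>X\<in>uminus ` {M. P M \<and> M \<subseteq> K}. - M \<subseteq> X \<longrightarrow> X = - M"
    by auto
  show ?thesis
  proof (rule that[OF M])
    fix N assume N: "P N" "N \<subseteq> M"
    then have "- N = - M" using max M by blast
    then show "N = M" by simp
  qed
qed

text \<open>Compactness enters through the subsets named in the lemmas, so that the space of all
  functions on predicates can be the carrier, with the ultrafilters as a closed subset.\<close>

locale compact_right_topological_semigroup =
  fixes mul :: "'b::t2_space \<Rightarrow> 'b \<Rightarrow> 'b" (infixl "\<odot>" 70)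
  assumes assoc: "(x \<odot> y) \<odot> z = x \<odot> (y \<odot> z)"
    and continuous: "continuous_on UNIV (\<lambda>x. x \<odot> y)"
begin

lemma compact_translate: "compact M \<Longrightarrow> compact ((\<lambda>x. x \<odot> y) ` M)"
  using compact_continuous_image continuous continuous_on_subset by blast

text \<open>Ellis-Numakura: a minimal compact subsemigroup \<open>M\<close> satisfies
  \<open>M \<odot> e = M\<close>, so some \<open>f\<close> in it has \<open>f \<odot> e = e\<close>.
  The elements with this property form a compact subsemigroup, which is all of \<open>M\<close> and
  so contains \<open>e\<close>.\<close>

lemma ellis_idempotent:
  assumes "compact K" "K \<noteq> {}" "\<And>x y. x \<in> K \<Longrightarrow> y \<in> K \<Longrightarrow> x \<odot> y \<in> K"
  obtains e where "e \<in> K" "e \<odot> e = e"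
proof -
  define P where "P M \<longleftrightarrow> compact M \<and> M \<noteq> {} \<and> (\<forall>x\<in>M. \<forall>y\<in>M. x \<odot> y \<in> M)" for M
  obtain M where M: "P M" "M \<subseteq> K" and min: "\<And>N. P N \<Longrightarrow> N \<subseteq> M \<Longrightarrow> N = M"
  proof (rule compact_minimal_subset[of P K])
    show "P K" using assms by (auto simp: P_def)
  qed (auto simp: P_def)
  from M(1) have closedM: "x \<odot> y \<in> M" if "x \<in> M" "y \<in> M" for x y
    using that by (auto simp: P_def)
  obtain e where e: "e \<in> M" using M(1) by (auto simp: P_def)
  have "(\<lambda>x. x \<odot> e) ` M = M"
  proof (rule min)
    show "(\<lambda>x. x \<odot> e) ` M \<subseteq> M" using e closedM by auto
    then have "(x \<odot> e) \<odot> (y \<odot> e) \<in> (\<lambda>x. x \<odot> e) ` M" if "x \<in> M" "y \<in> M" for x y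
      using that closedM e assoc by (metis imageI)
    then show "P ((\<lambda>x. x \<odot> e) ` M)"
      using M(1) compact_translate by (auto simp: P_def)
  qed
  then obtain f where f: "f \<in> M" "f \<odot> e = e" using e by (metis imageE)
  have "M \<inter> {x. x \<odot> e = e} = M"
  proof (rule min)
    have "closed {x. x \<odot> e = e}"
      by (intro closed_Collect_eq continuous continuous_on_const)
    then have "compact (M \<inter> {x. x \<odot> e = e})"
      using M(1) compact_Int_closed by (auto simp: P_def)
    then show "P (M \<inter> {x. x \<odot> e = e})"
      using f closedM by (auto simp: P_def assoc)
  qed auto
  then show ?thesis using that e M(2) by blast
qed

text \<open>A minimal left ideal of \<open>W\<close> supplies \<open>p\<close>; the idempotent \<open>q\<close> is \<open>p \<odot> e\<close> for an idempotent
  \<open>e\<close> of \<open>V \<odot> p\<close>. Then every \<open>h q\<close> is an idempotent below \<open>p\<close>, hence equal to \<open>p\<close>.\<close>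

lemma idempotent_pair:
  assumes W: "compact W" "W \<noteq> {}" and V: "compact V" "V \<noteq> {}"
    and WW: "\<And>x y. x \<in> W \<Longrightarrow> y \<in> W \<Longrightarrow> x \<odot> y \<in> W"
    and WV: "\<And>x y. x \<in> W \<Longrightarrow> y \<in> V \<Longrightarrow> x \<odot> y \<in> V"
    and VW: "\<And>x y. x \<in> V \<Longrightarrow> y \<in> W \<Longrightarrow> x \<odot> y \<in> V"
    and VV: "\<And>x y. x \<in> V \<Longrightarrow> y \<in> V \<Longrightarrow> x \<odot> y \<in> V"
  obtains p q where "p \<in> W" "q \<in> V" "p \<odot> p = p" "q \<odot> q = q" "p \<odot> q = q" "q \<odot> p = q"
    "\<And>h. (\<And>x y. h (x \<odot> y) = h x \<odot> h y) \<Longrightarrow> (\<And>x. x \<in> W \<Longrightarrow> h x = x) \<Longrightarrow>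
      (\<And>x. x \<in> V \<Longrightarrow> h x \<in> W) \<Longrightarrow> h q = p"
proof -
  define P where "P L \<longleftrightarrow> compact L \<and> L \<noteq> {} \<and> L \<subseteq> W \<and> (\<forall>x\<in>W. \<forall>y\<in>L. x \<odot> y \<in> L)" for L
  obtain L where L: "P L" and min: "\<And>N. P N \<Longrightarrow> N \<subseteq> L \<Longrightarrow> N = L"
  proof (rule compact_minimal_subset[of P W])
    show "P W" using W WW by (auto simp: P_def)
  next
    fix \<C> assume "\<C> \<noteq> {}" "\<And>M. M \<in> \<C> \<Longrightarrow> P M" "compact (\<Inter>\<C>)" "\<Inter>\<C> \<noteq> {}"
    then show "P (\<Inter>\<C>)" unfolding P_def by blast
  qed (auto simp: P_def)
  obtain p where p: "p \<in> L" "p \<odot> p = p"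
    by (rule ellis_idempotent[of L]) (use L in \<open>auto simp: P_def\<close>)
  have pW: "p \<in> W" using p L by (auto simp: P_def)
  \<comment> \<open>The left ideal \<open>W \<odot> f\<close> lies inside \<open>L\<close>, so
    minimality makes it equal to \<open>L\<close>.\<close>
  have left: "p \<in> (\<lambda>x. x \<odot> f) ` W" if "f \<in> L" for f
  proof -
    have "(\<lambda>x. x \<odot> f) ` W = L"
    proof (rule min)
      have "f \<in> W" using L that by (auto simp: P_def)
      then show "P ((\<lambda>x. x \<odot> f) ` W)"
        unfolding P_def using W compact_translate WW by (auto simp: assoc[symmetric])
      show "(\<lambda>x. x \<odot> f) ` W \<subseteq> L" using L that by (auto simp: P_def)
    qed
    then show ?thesis using p by simp
  qed
  obtain e where e: "e \<in> (\<lambda>x. x \<odot> p) ` V" "e \<odot> e = e"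
  proof (rule ellis_idempotent[of "(\<lambda>x. x \<odot> p) ` V"])
    fix x y assume "x \<in> (\<lambda>x. x \<odot> p) ` V" "y \<in> (\<lambda>x. x \<odot> p) ` V"
    then obtain a b where ab: "x = a \<odot> p" "y = b \<odot> p" "a \<in> V" "b \<in> V" by blast
    then have "x \<odot> y = (a \<odot> p \<odot> b) \<odot> p" by (simp add: assoc)
    moreover have "a \<odot> p \<odot> b \<in> V" using ab pW VW VV by blast
    ultimately show "x \<odot> y \<in> (\<lambda>x. x \<odot> p) ` V" by blast
  qed (use V compact_translate in auto)
  then obtain v where v: "v \<in> V" "e = v \<odot> p" by blast
  have ep: "e \<odot> p = e" using v p by (simp add: assoc)
  \<comment> \<open>As \<open>e \<odot> p = e\<close> already holds, the extra factor
    \<open>p\<close> makes \<open>q\<close> absorb \<open>p\<close> on both sides and keeps it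
    idempotent.\<close>
  define q where "q = p \<odot> e"
  have qp: "q \<odot> p = q" using ep by (simp add: q_def assoc)
  have pq: "p \<odot> q = q" using p by (simp add: q_def assoc[symmetric])
  have qq: "q \<odot> q = q" using ep e by (metis q_def assoc)
  have qV: "q \<in> V" using v pW WV VW by (simp add: q_def)
  show ?thesis
  proof (rule that[OF pW qV p(2) qq pq qp])
    fix h assume hom: "\<And>x y. h (x \<odot> y) = h x \<odot> h y" and id: "\<And>x. x \<in> W \<Longrightarrow> h x = x"
      and VW': "\<And>x. x \<in> V \<Longrightarrow> h x \<in> W"
    have hp: "h p = p" using id pW by simp
    have idem: "h q \<odot> h q = h q" and ph: "p \<odot> h q = h q" and hp': "h q \<odot> p = h q"
      using hom hp qq pq qp by metis+
    \<comment> \<open>Once \<open>h q\<close> is in \<open>L\<close>, minimality gives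
      \<open>p = x \<odot> h q\<close>; multiplying by the idempotent \<open>h q\<close> on the
      right yields \<open>p \<odot> h q = p\<close>.\<close>
    have "h q \<odot> p \<in> L" using L p VW' qV by (auto simp: P_def)
    then have "h q \<in> L" using hp' by simp
    then obtain x where "p = x \<odot> h q" using left by blast
    then have "p \<odot> h q = p" using idem by (simp add: assoc)
    then show "h q = p" using ph by simp
  qed
qed

end

subsection \<open>The semigroup of ultrafilters\<close>

text \<open>Ultrafilters are Boolean homomorphisms on predicates, so that the topology of the
  \<open>\<beta>\<close>-compactification is the product topology of the function space.\<close>

definition ultrafilters :: "(('x \<Rightarrow> bool) \<Rightarrow> bool) set" where
  "ultrafilters = {U. (\<forall>P Q. U (\<lambda>x. P x \<and> Q x) = (U P \<and> U Q)) \<and> (\<forall>P. U (\<lambda>x. \<not> P x) = (\<not> U P))}"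

text \<open>The extension of \<open>f\<close> to the \<beta>-compactification: a set is large if for
  \<open>U\<close>-most \<open>x\<close> it contains \<open>f x y\<close> for \<open>V\<close>-most
  \<open>y\<close>.\<close>

definition convolution ::
    "('x \<Rightarrow> 'x \<Rightarrow> 'x) \<Rightarrow> (('x \<Rightarrow> bool) \<Rightarrow> bool) \<Rightarrow> (('x \<Rightarrow> bool) \<Rightarrow> bool) \<Rightarrow> ('x \<Rightarrow> bool) \<Rightarrow> bool" where
  "convolution f U V P = U (\<lambda>x. V (\<lambda>y. P (f x y)))"

definition pushforward :: "('x \<Rightarrow> 'y) \<Rightarrow> (('x \<Rightarrow> bool) \<Rightarrow> bool) \<Rightarrow> ('y \<Rightarrow> bool) \<Rightarrow> bool" where
  "pushforward T U P = U (\<lambda>x. P (T x))"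

text \<open>With \<open>S N\<close> the words of one kind supported on positions from
  \<open>N\<close> on, this expresses concentration far to the right.\<close>

definition ultrafilters_on :: "(nat \<Rightarrow> 'x set) \<Rightarrow> (('x \<Rightarrow> bool) \<Rightarrow> bool) set" where
  "ultrafilters_on S = {U \<in> ultrafilters. \<forall>N. U (\<lambda>x. x \<in> S N)}"

lemma ultrafilter_conj: "U \<in> ultrafilters \<Longrightarrow> U (\<lambda>x. P x \<and> Q x) \<longleftrightarrow> U P \<and> U Q"
  and ultrafilter_not: "U \<in> ultrafilters \<Longrightarrow> U (\<lambda>x. \<not> P x) \<longleftrightarrow> \<not> U P"
  by (auto simp: ultrafilters_def)

lemma ultrafilter_mono:
  assumes "U \<in> ultrafilters" "U P" "\<And>x. P x \<Longrightarrow> Q x"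
  shows "U Q"
proof -
  have "(\<lambda>x. P x \<and> Q x) = P" using assms(3) by auto
  then show ?thesis using ultrafilter_conj[OF assms(1), of P Q] assms(2) by simp
qed

lemma ultrafilter_True:
  assumes "U \<in> ultrafilters"
  shows "U (\<lambda>x. True)"
  using ultrafilter_mono[OF assms, of _ "\<lambda>x. True"] ultrafilter_not[OF assms, of "\<lambda>x. True"] by blast

lemma ultrafilter_obtain:
  assumes "U \<in> ultrafilters" "U P"
  obtains x where "P x"
proof (rule ccontr)
  assume "\<not> thesis"
  then have "\<not> P x" for x using that by blast
  then have "U (\<lambda>x. \<not> True)" by (metis (full_types) assms(2) ext)
  then show False using ultrafilter_not[OF assms(1), of "\<lambda>x. True"] ultrafilter_True[OF assms(1)] by simp
qed

lemma ultrafilter_ball: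
  assumes U: "U \<in> ultrafilters" and "finite I" "\<And>i. i \<in> I \<Longrightarrow> U (P i)"
  shows "U (\<lambda>x. \<forall>i\<in>I. P i x)"
  using assms(2,3)
  by (induction I rule: finite_induct) (auto simp: ultrafilter_True[OF U] ultrafilter_conj[OF U])

lemma ultrafilter_bex:
  assumes U: "U \<in> ultrafilters" and "finite I" "U (\<lambda>x. \<exists>i\<in>I. P i x)"
  obtains i where "i \<in> I" "U (P i)"
proof (rule ccontr)
  assume "\<not> thesis"
  then have "U (\<lambda>x. \<not> P i x)" if "i \<in> I" for i
    using that \<open>i \<in> I\<close> ultrafilter_not[OF U] \<open>\<And>i. i \<in> I \<Longrightarrow> U (P i) \<Longrightarrow> thesis\<close> by blast
  then have "U (\<lambda>x. \<forall>i\<in>I. \<not> P i x)" using assms(2) by (intro ultrafilter_ball[OF U])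
  then show False using assms(3) ultrafilter_not[OF U, of "\<lambda>x. \<exists>i\<in>I. P i x"] by simp
qed

lemma closed_ultrafilters: "closed (ultrafilters :: (('x \<Rightarrow> bool) \<Rightarrow> bool) set)"
proof -
  have ev: "continuous_on UNIV (\<lambda>U :: ('x \<Rightarrow> bool) \<Rightarrow> bool. U P)" for P
    by simp
  have conj: "continuous_on UNIV (\<lambda>U :: ('x \<Rightarrow> bool) \<Rightarrow> bool. U P \<and> U Q)" for P Q
  proof -
    have "min a b \<longleftrightarrow> a \<and> b" for a b by (cases a; cases b) auto
    then show ?thesis using continuous_on_min[OF ev[of P] ev[of Q]] by presburger
  qed
  have neg: "continuous_on UNIV (\<lambda>U :: ('x \<Rightarrow> bool) \<Rightarrow> bool. \<not> U P)" for P
    using continuous_on_compose2[OF continuous_on_discrete[of UNIV Not] ev[of P]] by simp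
  have "(ultrafilters :: (('x \<Rightarrow> bool) \<Rightarrow> bool) set) =
      (\<Inter>P. \<Inter>Q. {U. U (\<lambda>x. P x \<and> Q x) = (U P \<and> U Q)}) \<inter> (\<Inter>P. {U. U (\<lambda>x. \<not> P x) = (\<not> U P)})"
    by (auto simp: ultrafilters_def)
  also have "closed \<dots>"
    by (intro closed_Int closed_INT ballI closed_Collect_eq ev conj neg)
  finally show ?thesis .
qed

lemma compact_ultrafilter_space: "compact (UNIV :: (('x \<Rightarrow> bool) \<Rightarrow> bool) set)"
  by (intro compact_UNIV_fun finite_imp_compact) simp

lemma closed_ultrafilters_on: "closed (ultrafilters_on S)"
proof -
  have "ultrafilters_on S = ultrafilters \<inter> (\<Inter>N. {U. U (\<lambda>x. x \<in> S N) = True})"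
    by (auto simp: ultrafilters_on_def)
  also have "closed \<dots>"
    by (intro closed_Int closed_INT ballI closed_Collect_eq closed_ultrafilters continuous_on_const) simp
  finally show ?thesis .
qed

lemma compact_ultrafilters_on: "compact (ultrafilters_on S)"
  using compact_Int_closed[OF compact_ultrafilter_space closed_ultrafilters_on] by simp

text \<open>By compactness finitely many sets \<open>S N\<close> may be treated at a time, and the
  principal ultrafilter of a point in a late enough \<open>S M\<close> contains them all.\<close>

lemma ultrafilters_on_nonempty:
  assumes "antimono S" "\<And>N. S N \<noteq> {}"
  shows "ultrafilters_on S \<noteq> {}"
proof -
  have "UNIV \<inter> (\<Inter>N. ultrafilters \<inter> {U. U (\<lambda>x. x \<in> S N) = True}) \<noteq> {}"
  proof (rule compact_imp_fip_image[OF compact_ultrafilter_space])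
    show "closed (ultrafilters \<inter> {U. U (\<lambda>x. x \<in> S N) = True})" for N
      by (intro closed_Int closed_Collect_eq closed_ultrafilters continuous_on_const) simp
  next
    fix I :: "nat set" assume "finite I"
    then obtain M where M: "\<And>i. i \<in> I \<Longrightarrow> i \<le> M" by (meson Max_ge)
    obtain x where "x \<in> S M" using assms(2) by blast
    then have "x \<in> S i" if "i \<in> I" for i
      using M[OF that] assms(1) by (auto dest: antimonoD)
    then have "(\<lambda>P. P x) \<in> UNIV \<inter> (\<Inter>N\<in>I. ultrafilters \<inter> {U. U (\<lambda>x. x \<in> S N) = True})"
      by (auto simp: ultrafilters_def)
    then show "UNIV \<inter> (\<Inter>N\<in>I. ultrafilters \<inter> {U. U (\<lambda>x. x \<in> S N) = True}) \<noteq> {}"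
      by blast
  qed
  then show ?thesis by (auto simp: ultrafilters_on_def)
qed

section \<open>Convolutions and images of ultrafilters concentrated on tails\<close>

text \<open>The inner ultrafilter is evaluated with \<open>x\<close> fixed, so \<open>M\<close> may
  depend on \<open>x\<close>: the right factor can be pushed past the whole domain of the left
  one.\<close>

lemma convolution_ultrafilters_on:
  assumes U: "U \<in> ultrafilters_on A" and V: "V \<in> ultrafilters_on B"
    and tail: "\<And>N x. x \<in> A N \<Longrightarrow> \<exists>M. \<forall>y\<in>B M. f x y \<in> C N"
  shows "convolution f U V \<in> ultrafilters_on C"
proof -
  have U': "U \<in> ultrafilters" and V': "V \<in> ultrafilters"
    using U V by (auto simp: ultrafilters_on_def)
  have "convolution f U V \<in> ultrafilters"
    using ultrafilter_conj[OF U'] ultrafilter_conj[OF V'] ultrafilter_not[OF U'] ultrafilter_not[OF V']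
    by (simp add: ultrafilters_def convolution_def)
  moreover have "convolution f U V (\<lambda>x. x \<in> C N)" for N
    unfolding convolution_def
  proof (rule ultrafilter_mono[OF U'])
    show "U (\<lambda>x. x \<in> A N)" using U by (auto simp: ultrafilters_on_def)
    fix x assume "x \<in> A N"
    then obtain M where M: "\<forall>y\<in>B M. f x y \<in> C N" using tail by blast
    show "V (\<lambda>y. f x y \<in> C N)"
      by (rule ultrafilter_mono[OF V', of "\<lambda>y. y \<in> B M"])
        (use V M in \<open>auto simp: ultrafilters_on_def\<close>)
  qed
  ultimately show ?thesis by (simp add: ultrafilters_on_def)
qed

lemma pushforward_ultrafilters_on:
  assumes U: "U \<in> ultrafilters_on A" and T: "\<And>N x. x \<in> A N \<Longrightarrow> T x \<in> B N"
  shows "pushforward T U \<in> ultrafilters_on B"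
proof -
  have U': "U \<in> ultrafilters" using U by (auto simp: ultrafilters_on_def)
  have "U (\<lambda>x. T x \<in> B N)" for N
    by (rule ultrafilter_mono[OF U', of "\<lambda>x. x \<in> A N"]) (use U T in \<open>auto simp: ultrafilters_on_def\<close>)
  then show ?thesis
    using ultrafilter_conj[OF U'] ultrafilter_not[OF U']
    by (simp add: ultrafilters_on_def ultrafilters_def pushforward_def)
qed

lemma pushforward_id:
  assumes U: "U \<in> ultrafilters_on A" and T: "\<And>x. x \<in> A 0 \<Longrightarrow> T x = x"
  shows "pushforward T U = U"
proof
  fix P
  have U': "U \<in> ultrafilters" and A: "U (\<lambda>x. x \<in> A 0)"
    using U by (auto simp: ultrafilters_on_def)
  have eq: "(\<lambda>x. x \<in> A 0 \<and> P (T x)) = (\<lambda>x. x \<in> A 0 \<and> P x)" using T by fastforce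
  show "pushforward T U P = U P"
    using ultrafilter_conj[OF U', of "\<lambda>x. x \<in> A 0"] A arg_cong[OF eq, of U]
    by (simp add: pushforward_def)
qed

text \<open>Each coordinate of the convolution evaluates \<open>U\<close> at a predicate independent
  of \<open>U\<close>, whence continuity in \<open>U\<close>.\<close>

lemma compact_right_topological_semigroup_convolution:
  assumes "\<And>x y z. f (f x y) z = f x (f y z)"
  shows "compact_right_topological_semigroup (convolution f)"
proof
  show "convolution f (convolution f U V) W = convolution f U (convolution f V W)" for U V W
    by (simp add: convolution_def assms fun_eq_iff)
  show "continuous_on UNIV (\<lambda>U. convolution f U V)" for V
    unfolding convolution_def by (intro continuous_on_coordinatewise_then_product) simp
qed

lemma pushforward_convolution:
  assumes "\<And>x y. T (f x y) = f (T x) (T y)"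
  shows "pushforward T (convolution f U V) = convolution f (pushforward T U) (pushforward T V)"
  by (simp add: convolution_def pushforward_def assms fun_eq_iff)

subsection \<open>Located words\<close>

lemma map_add_const_words:
  assumes "x \<in> const_words \<alpha> k" "y \<in> const_words \<alpha> k"
  shows "x ++ y \<in> const_words \<alpha> k"
proof -
  have "the ((x ++ y) n) \<in> \<alpha> ` {1..k n}" if "n \<in> dom (x ++ y)" for n
    using that assms by (cases "n \<in> dom y") (auto simp: map_add_dom_app_simps const_words_def)
  then show ?thesis using assms by (auto simp: const_words_def)
qed

text \<open>\<open>++\<close> favours its right operand: a variable of \<open>y\<close> always
  survives, one of \<open>x\<close> only where \<open>y\<close> is undefined.\<close>

lemma map_add_var_words:
  assumes "x \<in> const_words \<alpha> k \<union> var_words \<alpha> \<upsilon> k" "y \<in> const_words \<alpha> k \<union> var_words \<alpha> \<upsilon> k"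
    and "y \<in> var_words \<alpha> \<upsilon> k \<or> x \<in> var_words \<alpha> \<upsilon> k \<and> dom x \<inter> dom y = {}"
  shows "x ++ y \<in> var_words \<alpha> \<upsilon> k"
proof -
  have letters: "the (z n) \<in> insert \<upsilon> (\<alpha> ` {1..k n})"
    if "z \<in> const_words \<alpha> k \<union> var_words \<alpha> \<upsilon> k" "n \<in> dom z" for z n
    using that by (auto simp: const_words_def var_words_def)
  have "the ((x ++ y) n) \<in> insert \<upsilon> (\<alpha> ` {1..k n})" if "n \<in> dom (x ++ y)" for n
    using that letters[OF assms(1), of n] letters[OF assms(2), of n]
    by (cases "n \<in> dom y") (auto simp: map_add_dom_app_simps)
  moreover have "\<exists>n\<in>dom (x ++ y). (x ++ y) n = Some \<upsilon>"
    using assms(3)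
  proof
    assume "y \<in> var_words \<alpha> \<upsilon> k"
    then obtain n where "y n = Some \<upsilon>" by (auto simp: var_words_def)
    then show ?thesis by (intro bexI[of _ n]) auto
  next
    assume *: "x \<in> var_words \<alpha> \<upsilon> k \<and> dom x \<inter> dom y = {}"
    then obtain n where "x n = Some \<upsilon>" by (auto simp: var_words_def)
    moreover from this * have "n \<notin> dom y" by auto
    ultimately show ?thesis by (intro bexI[of _ n]) (auto simp: map_add_dom_app_simps)
  qed
  ultimately show ?thesis
    using assms(1,2) by (auto simp: const_words_def var_words_def)
qed

lemma dom_subst [simp]: "dom (subst \<alpha> \<upsilon> k p x) = dom x"
  by (auto simp: subst_def dom_def)

lemma subst_eq_None_iff: "subst \<alpha> \<upsilon> k p x i = None \<longleftrightarrow> x i = None"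
  using dom_subst[of \<alpha> \<upsilon> k p x] by (metis domIff)

lemma subst_0 [simp]: "subst \<alpha> \<upsilon> k 0 x = x"
  by (simp add: subst_def)

lemma subst_map_add: "subst \<alpha> \<upsilon> k p (x ++ y) = subst \<alpha> \<upsilon> k p x ++ subst \<alpha> \<upsilon> k p y"
  by (auto simp: subst_def map_add_def fun_eq_iff split: option.splits)

lemma subst_const_words:
  assumes "\<upsilon> \<notin> \<alpha> ` {1..}" "x \<in> const_words \<alpha> k"
  shows "subst \<alpha> \<upsilon> k p x = x"
proof
  fix n
  show "subst \<alpha> \<upsilon> k p x n = x n"
  proof (cases "x n")
    case (Some a)
    then have "a \<in> \<alpha> ` {1..k n}" using assms(2) by (force simp: const_words_def)
    then have "a \<noteq> \<upsilon>" using assms(1) by auto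
    then show ?thesis using Some by (simp add: subst_def)
  qed (simp add: subst_def)
qed

lemma subst_var_words:
  assumes "\<forall>n\<ge>1. k n \<ge> 1" "x \<in> var_words \<alpha> \<upsilon> k" "p \<ge> 1"
  shows "subst \<alpha> \<upsilon> k p x \<in> const_words \<alpha> k"
proof -
  have "the (subst \<alpha> \<upsilon> k p x n) \<in> \<alpha> ` {1..k n}" if "n \<in> dom x" for n
  proof -
    have "k n \<ge> 1" "the (x n) \<in> insert \<upsilon> (\<alpha> ` {1..k n})"
      using assms that by (auto simp: var_words_def)
    then show ?thesis using that assms(3) by (auto simp: subst_def)
  qed
  moreover have "finite (dom x) \<and> dom x \<noteq> {} \<and> dom x \<subseteq> {1..}"
    using assms(2) by (simp add: var_words_def)
  ultimately show ?thesis unfolding const_words_def mem_Collect_eq dom_subst by blast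
qed

section \<open>The two idempotents on index words\<close>

text \<open>Each substitution with \<open>a \<ge> 1\<close> is an endomorphism that fixes constant
  words and makes variable words constant, as the last clause of \<open>idempotent_pair\<close>
  asks. There \<open>p\<close> and \<open>q\<close> precede \<open>h\<close>, so one pair serves all
  \<open>a\<close>.\<close>

lemma idempotents_on_words:
  fixes k :: "nat \<Rightarrow> nat"
  assumes k: "\<forall>n\<ge>1. k n \<ge> 1"
  defines "c \<equiv> convolution (++)"
  obtains p q where
    "p \<in> ultrafilters_on (\<lambda>N. {x \<in> const_words id k. dom x \<subseteq> {N..}})"
    "q \<in> ultrafilters_on (\<lambda>N. {x \<in> var_words id 0 k. dom x \<subseteq> {N..}})"
    "c p p = p" "c q q = q" "c p q = q" "c q p = q"
    "\<forall>a\<ge>1. pushforward (subst id 0 k a) q = p"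
proof -
  define W where "W = (\<lambda>N. {x \<in> const_words id k. dom x \<subseteq> {N..}})"
  define V where "V = (\<lambda>N. {x \<in> var_words id (0::nat) k. dom x \<subseteq> {N..}})"
  interpret compact_right_topological_semigroup c
    unfolding c_def by (rule compact_right_topological_semigroup_convolution) simp
  have finite_dom: "finite (dom x)" if "x \<in> W N \<union> V N" for x N
    using that by (auto simp: W_def V_def const_words_def var_words_def)
  have anti: "antimono W" "antimono V" by (auto simp: antimono_def W_def V_def)
  \<comment> \<open>Positions start at 1, hence \<open>Suc N\<close>; the letter 1 is available
    since \<open>k\<close> is at least 1.\<close>
  have "[Suc N \<mapsto> 1] \<in> W N" "[Suc N \<mapsto> 0] \<in> V N" for N
    using k by (auto simp: W_def V_def const_words_def var_words_def)
  then have ne: "ultrafilters_on W \<noteq> {}" "ultrafilters_on V \<noteq> {}"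
    using ultrafilters_on_nonempty[OF anti(1)] ultrafilters_on_nonempty[OF anti(2)] by blast+
  have WW: "c U U' \<in> ultrafilters_on W" if "U \<in> ultrafilters_on W" "U' \<in> ultrafilters_on W" for U U'
    unfolding c_def
  proof (rule convolution_ultrafilters_on[OF that])
    show "\<exists>M. \<forall>y\<in>W M. x ++ y \<in> W N" if "x \<in> W N" for N x
      using that by (intro exI[of _ N]) (auto simp: W_def intro: map_add_const_words)
  qed
  have WV: "c U U' \<in> ultrafilters_on V" if "U \<in> ultrafilters_on W" "U' \<in> ultrafilters_on V" for U U'
    unfolding c_def
  proof (rule convolution_ultrafilters_on[OF that])
    show "\<exists>M. \<forall>y\<in>V M. x ++ y \<in> V N" if "x \<in> W N" for N x
      using that by (intro exI[of _ N]) (auto simp: W_def V_def intro: map_add_var_words)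
  qed
  have VV: "c U U' \<in> ultrafilters_on V" if "U \<in> ultrafilters_on V" "U' \<in> ultrafilters_on V" for U U'
    unfolding c_def
  proof (rule convolution_ultrafilters_on[OF that])
    show "\<exists>M. \<forall>y\<in>V M. x ++ y \<in> V N" if "x \<in> V N" for N x
      using that by (intro exI[of _ N]) (auto simp: V_def intro: map_add_var_words)
  qed
  have VW: "c U U' \<in> ultrafilters_on V" if "U \<in> ultrafilters_on V" "U' \<in> ultrafilters_on W" for U U'
    unfolding c_def
  proof (rule convolution_ultrafilters_on[OF that])
    fix N x assume x: "x \<in> V N"
    \<comment> \<open>Here the only variables sit in the left factor and could be overwritten, so
      \<open>y\<close> is taken beyond \<open>dom x\<close>.\<close>
    obtain M where M: "\<And>n. n \<in> dom x \<Longrightarrow> n < M"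
      using finite_dom[of x N] x by (metis UnI2 bounded_nat_set_is_finite finite_nat_set_iff_bounded)
    have "x ++ y \<in> V N" if "y \<in> W (max N M)" for y
    proof -
      have "dom x \<inter> dom y = {}" using M that by (fastforce simp: W_def)
      then show ?thesis using x that by (auto simp: W_def V_def intro!: map_add_var_words)
    qed
    then show "\<exists>M. \<forall>y\<in>W M. x ++ y \<in> V N" by blast
  qed
  show ?thesis
  proof (rule idempotent_pair[OF compact_ultrafilters_on ne(1) compact_ultrafilters_on ne(2) WW WV VW VV])
    fix p q assume pq: "p \<in> ultrafilters_on W" "q \<in> ultrafilters_on V"
        "c p p = p" "c q q = q" "c p q = q" "c q p = q"
      and h: "\<And>h. (\<And>x y. h (c x y) = c (h x) (h y)) \<Longrightarrow> (\<And>x. x \<in> ultrafilters_on W \<Longrightarrow> h x = x) \<Longrightarrow>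
        (\<And>x. x \<in> ultrafilters_on V \<Longrightarrow> h x \<in> ultrafilters_on W) \<Longrightarrow> h q = p"
    have "pushforward (subst id 0 k a) q = p" if "a \<ge> 1" for a
    proof (rule h)
      show "pushforward (subst id 0 k a) (c U U') =
          c (pushforward (subst id 0 k a) U) (pushforward (subst id 0 k a) U')" for U U'
        unfolding c_def by (rule pushforward_convolution) (rule subst_map_add)
      show "pushforward (subst id 0 k a) U = U" if "U \<in> ultrafilters_on W" for U
        by (rule pushforward_id[OF that]) (auto simp: W_def intro: subst_const_words)
      show "pushforward (subst id 0 k a) U \<in> ultrafilters_on W" if "U \<in> ultrafilters_on V" for U
        by (rule pushforward_ultrafilters_on[OF that])
          (use \<open>a \<ge> 1\<close> k in \<open>auto simp: W_def V_def intro: subst_var_words\<close>)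
    qed
    then show ?thesis using that[OF pq[unfolded W_def V_def]] by blast
  qed
qed

section \<open>Products of lists of words\<close>

lemma star_list_Nil [simp]: "star_list [] = Map.empty"
  and star_list_Cons [simp]: "star_list (x # xs) = x ++ star_list xs"
  by (simp_all add: star_list_def)

lemma star_list_append: "star_list (xs @ ys) = star_list xs ++ star_list ys"
  by (induction xs) simp_all

lemma star_list_hom:
  assumes "h Map.empty = Map.empty" "\<And>x y. h (x ++ y) = h x ++ h y"
  shows "h (star_list xs) = star_list (map h xs)"
  by (induction xs) (simp_all add: assms)

text \<open>All factors take their values from the same \<open>x\<close>, so repetitions in
  \<open>ns\<close> agree and the order is immaterial.\<close>

lemma star_list_singletons:
  assumes "set ns \<subseteq> dom x"
  shows "star_list (map (\<lambda>n. [n \<mapsto> the (x n)]) ns) = x |` set ns"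
  using assms
proof (induction ns)
  case (Cons n ns)
  then have "star_list (map (\<lambda>n. [n \<mapsto> the (x n)]) (n # ns)) = [n \<mapsto> the (x n)] ++ x |` set ns"
    by (simp del: fun_upd_apply)
  also have "\<dots> = x |` set (n # ns)"
    using Cons.prems by (auto simp: fun_eq_iff map_add_def restrict_map_def split: option.splits)
  finally show ?case .
qed simp

text \<open>With disjoint domains no symbol is overwritten. This serves to see whether a product
  still contains the variable.\<close>

lemma ran_star_list:
  assumes "\<And>i j. i < j \<Longrightarrow> j < length xs \<Longrightarrow> dom (xs ! i) \<inter> dom (xs ! j) = {}"
  shows "ran (star_list xs) = (\<Union>x\<in>set xs. ran x)"
  using assms
proof (induction xs)
  case (Cons x xs)
  have dom_star: "dom (star_list ys) = (\<Union>y\<in>set ys. dom y)" for ys :: "'a lword list"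
    by (induction ys) auto
  have "dom (xs ! i) \<inter> dom (xs ! j) = {}" if "i < j" "j < length xs" for i j
    using Cons.prems[of "Suc i" "Suc j"] that by simp
  then have IH: "ran (star_list xs) = (\<Union>x\<in>set xs. ran x)" by (rule Cons.IH)
  have "dom x \<inter> dom y = {}" if "y \<in> set xs" for y
    using Cons.prems[of 0] that by (fastforce simp: in_set_conv_nth)
  then have "dom x \<inter> dom (star_list xs) = {}" unfolding dom_star by blast
  then show ?case by (simp add: ran_map_add IH)
qed simp

section \<open>The Galvin-Glazer construction\<close>

lemma sequence_with_large_products:
  fixes k :: "nat \<Rightarrow> nat"
  defines "c \<equiv> convolution (++)"
  assumes p: "p \<in> ultrafilters"
    and q: "q \<in> ultrafilters_on (\<lambda>N. {x \<in> var_words id 0 k. dom x \<subseteq> {N..}})"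
    and idem: "c p p = p" "c q q = q" "c p q = q" "c q p = q"
    and push: "\<forall>a\<ge>1. pushforward (subst id 0 k a) q = p"
    and D: "p D" "q D"
  obtains u where "u \<in> word_seqs id 0 k" "\<forall>n\<ge>1. dom (u n) \<subseteq> {n..}"
    "\<forall>l n a. l \<ge> 1 \<longrightarrow> strict_mono_on {1..l} n \<longrightarrow> (\<forall>i\<in>{1..l}. n i \<ge> 1 \<and> a i \<le> k (n i)) \<longrightarrow>
      D (star_list (map (\<lambda>i. subst id 0 k (a i) (u (n i))) [1..<Suc l]))"
proof -
  let ?T = "subst id (0::nat) k"
  define F where "F P \<longleftrightarrow> p P \<and> q P" for P
  have q': "q \<in> ultrafilters" using q by (simp add: ultrafilters_on_def)
  \<comment> \<open>All four products of \<open>p\<close> and \<open>q\<close> are again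
    \<open>p\<close> or \<open>q\<close>. Evaluating \<open>P\<close> in them shows that for most
    \<open>x\<close>, in either sense, most \<open>y\<close> keep \<open>x ++ y\<close> in
    \<open>P\<close>.\<close>
  have F_idem: "F (\<lambda>x. P x \<and> F (\<lambda>y. P (x ++ y)))" if "F P" for P
  proof -
    have "c p p P" "c q q P" "c p q P" "c q p P" using that by (simp_all add: F_def idem)
    then show ?thesis
      using that unfolding F_def c_def convolution_def
      by (simp add: ultrafilter_conj[OF p] ultrafilter_conj[OF q'])
  qed
  \<comment> \<open>The parameter 0 leaves \<open>q\<close> alone and every other one carries it to
    \<open>p\<close>, so a single word drawn from \<open>q\<close> controls all its
    instances.\<close>
  have q_subst: "q (\<lambda>x. P (?T a x))" if "F P" for P a
  proof (cases "a = 0")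
    case False
    then have "pushforward (?T a) q P" using that push by (simp add: F_def)
    then show ?thesis by (simp add: pushforward_def)
  qed (use that in \<open>simp add: F_def\<close>)
  \<comment> \<open>The invariant of the recursion concerns continuations only and leaves out
    \<open>D x\<close>: the empty product is good but need not satisfy \<open>D\<close>.\<close>
  define good where "good x \<longleftrightarrow> F (\<lambda>y. D (x ++ y))" for x
  \<comment> \<open>A state is a pair of the last chosen term and the set of all products, including the empty
    one, of instances of the terms chosen so far.\<close>
  define stage where "stage n s \<longleftrightarrow> finite (fst s) \<and> (\<forall>x\<in>fst s. good x) \<and> finite (dom (snd s)) \<and>
      (n = 0 \<longrightarrow> Map.empty \<in> fst s)" for n :: nat and s :: "nat lword set \<times> nat lword"
  define step where "step n s t \<longleftrightarrow> snd t \<in> var_words id 0 k \<and> dom (snd t) \<subseteq> {Suc n..} \<and>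
      (\<forall>i\<in>dom (snd s). \<forall>j\<in>dom (snd t). i < j) \<and>
      fst t = fst s \<union> (\<lambda>(x, a). x ++ ?T a (snd t)) ` (fst s \<times> {..k (Suc n)}) \<and>
      (\<forall>x\<in>fst s. \<forall>a\<le>k (Suc n). D (x ++ ?T a (snd t)))"
    for n :: nat and s t :: "nat lword set \<times> nat lword"
  have "\<exists>f. \<forall>n. stage n (f n) \<and> step n (f n) (f (Suc n))"
  proof (rule dependent_nat_choice)
    have "good Map.empty" using D by (simp add: good_def F_def)
    then show "\<exists>s. stage 0 s"
      unfolding stage_def
      by (intro exI[of _ "({Map.empty}, Map.empty)"]) simp
  next
    fix s :: "nat lword set \<times> nat lword" and n :: nat
    assume "stage n s"
    then have s: "finite (fst s)" "\<And>x. x \<in> fst s \<Longrightarrow> good x" "finite (dom (snd s))"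
      by (auto simp: stage_def)
    obtain M where M: "\<And>i. i \<in> dom (snd s) \<Longrightarrow> i < M"
      using s(3) by (metis bounded_nat_set_is_finite finite_nat_set_iff_bounded)
    \<comment> \<open>Beyond \<open>M\<close> the new term follows the previous one; beyond
      \<open>Suc n\<close> it stays at positions at least its own number, which later bounds its
      parameters.\<close>
    define N where "N = max M (Suc n)"
    have "q (\<lambda>v. \<forall>(x, a)\<in>fst s \<times> {..k (Suc n)}. D (x ++ ?T a v) \<and> good (x ++ ?T a v))"
    proof (rule ultrafilter_ball[OF q'])
      show "finite (fst s \<times> {..k (Suc n)})" using s by simp
      fix xa assume xa: "xa \<in> fst s \<times> {..k (Suc n)}"
      obtain x a where [simp]: "xa = (x, a)" by fastforce
      \<comment> \<open>By associativity \<open>good (x ++ y)\<close> is the second half of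
        \<open>F_idem\<close>.\<close>
      have "F (\<lambda>y. D (x ++ y) \<and> good (x ++ y))"
        using F_idem[of "\<lambda>y. D (x ++ y)"] s xa by (simp add: good_def)
      from q_subst[OF this, of a]
      show "q (\<lambda>v. case xa of (x, a) \<Rightarrow> D (x ++ ?T a v) \<and> good (x ++ ?T a v))" by simp
    qed
    moreover have "q (\<lambda>v. v \<in> {x \<in> var_words id 0 k. dom x \<subseteq> {N..}})"
      using q by (simp add: ultrafilters_on_def)
    ultimately have "q (\<lambda>v. v \<in> {x \<in> var_words id 0 k. dom x \<subseteq> {N..}} \<and>
        (\<forall>(x, a)\<in>fst s \<times> {..k (Suc n)}. D (x ++ ?T a v) \<and> good (x ++ ?T a v)))"
      by (simp only: ultrafilter_conj[OF q'])
    then obtain v where v: "v \<in> var_words id 0 k" "dom v \<subseteq> {N..}"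
        "\<And>x a. x \<in> fst s \<Longrightarrow> a \<le> k (Suc n) \<Longrightarrow> D (x ++ ?T a v) \<and> good (x ++ ?T a v)"
      by (rule ultrafilter_obtain[OF q']) blast
    have "finite (dom v)" using v(1) by (simp add: var_words_def)
    moreover have "dom v \<subseteq> {Suc n..}" using v(2) by (auto simp: N_def)
    moreover have "\<forall>i\<in>dom (snd s). \<forall>j\<in>dom v. i < j" using v(2) M by (fastforce simp: N_def)
    ultimately show "\<exists>t. stage (Suc n) t \<and> step n s t"
      unfolding stage_def step_def
      using s v
      by (intro exI[of _ "(fst s \<union> (\<lambda>(x, a). x ++ ?T a v) ` (fst s \<times> {..k (Suc n)}), v)"]) auto
  qed
  then obtain f where "\<forall>n. stage n (f n) \<and> step n (f n) (f (Suc n))" ..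
  then have f: "stage n (f n)" "step n (f n) (f (Suc n))" for n by auto
  \<comment> \<open>Passing from state \<open>n\<close> to state \<open>Suc n\<close> picks the term
    numbered \<open>Suc n\<close>, in line with the bound \<open>k (Suc n)\<close>; state 0 only
    starts the recursion.\<close>
  define R where "R n = fst (f n)" for n
  define u where "u n = snd (f n)" for n
  have u: "u (Suc n) \<in> var_words id 0 k" "dom (u (Suc n)) \<subseteq> {Suc n..}"
      "\<And>i j. i \<in> dom (u n) \<Longrightarrow> j \<in> dom (u (Suc n)) \<Longrightarrow> i < j" for n
    using f(2)[of n] unfolding u_def step_def by blast+
  have R0: "Map.empty \<in> R 0" using f(1)[of 0] by (simp add: R_def stage_def)
  have RD: "D (x ++ ?T a (u (Suc n)))" and R_step: "x ++ ?T a (u (Suc n)) \<in> R (Suc n)"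
    if "x \<in> R n" "a \<le> k (Suc n)" for x a n
    using f(2)[of n] that unfolding R_def u_def step_def by force+
  have "R n \<subseteq> R (Suc n)" for n using f(2)[of n] unfolding R_def step_def by blast
  then have R_mono: "m \<le> n \<Longrightarrow> R m \<subseteq> R n" for m n by (rule lift_Suc_mono_le)
  let ?s = "\<lambda>n a l. star_list (map (\<lambda>i. ?T (a i) (u (n i))) [1..<Suc l])"
  have s_Suc: "?s n a (Suc l) = ?s n a l ++ ?T (a (Suc l)) (u (n (Suc l)))" for n a l
    by (simp add: star_list_append)
  have prefix: "?s n a l \<in> R m"
    if "strict_mono_on {1..l} n" "\<forall>i\<in>{1..l}. 1 \<le> n i \<and> a i \<le> k (n i)" "\<forall>i\<in>{1..l}. n i \<le> m" for n a l m
    using that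
  proof (induction l arbitrary: m)
    case 0
    then show ?case using R0 R_mono[of 0 m] by auto
  next
    case (Suc l)
    \<comment> \<open>The earlier factors have indices at most \<open>m'\<close>, so their product
      is already in the stock \<open>R m'\<close> against which \<open>u (Suc m')\<close> was
      chosen.\<close>
    obtain m' where m': "n (Suc l) = Suc m'" using Suc.prems(2)[rule_format, of "Suc l"] by (cases "n (Suc l)") auto
    have "\<forall>i\<in>{1..l}. n i < n (Suc l)"
      using Suc.prems(1) by (auto simp: strict_mono_on_def)
    then have "?s n a l \<in> R m'"
      using Suc.prems m' by (intro Suc.IH) (auto simp: strict_mono_on_def)
    then have "?s n a (Suc l) \<in> R (Suc m')"
      unfolding s_Suc m' using Suc.prems(2)[rule_format, of "Suc l"] m' by (intro R_step) auto
    moreover have "Suc m' \<le> m" using Suc.prems(3)[rule_format, of "Suc l"] m' by simp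
    ultimately show ?case using R_mono by blast
  qed
  show ?thesis
  proof (rule that[of u])
    have u': "u n \<in> var_words id 0 k" "dom (u n) \<subseteq> {n..}" if "n \<ge> 1" for n
      using u(1,2)[of "n - 1"] that by auto
    then show "\<forall>n\<ge>1. dom (u n) \<subseteq> {n..}" by blast
    show "u \<in> word_seqs id 0 k"
      unfolding word_seqs_def word_less_def mem_Collect_eq
    proof (intro allI impI conjI u'(1))
      fix n :: nat assume "n \<ge> 1"
      then show "Max (dom (u n)) < Min (dom (u (Suc n)))"
        using u'(1)[of n] u'(1)[of "Suc n"]
        by (intro u(3)[of _ n] Max_in Min_in) (auto simp: var_words_def)
    qed
  next
    show "\<forall>l n a. l \<ge> 1 \<longrightarrow> strict_mono_on {1..l} n \<longrightarrow> (\<forall>i\<in>{1..l}. n i \<ge> 1 \<and> a i \<le> k (n i)) \<longrightarrow>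
      D (?s n a l)"
    proof (intro allI impI)
      fix l and n a :: "nat \<Rightarrow> nat"
      assume "l \<ge> 1" and n: "strict_mono_on {1..l} n" "\<forall>i\<in>{1..l}. n i \<ge> 1 \<and> a i \<le> k (n i)"
      then obtain l' where l': "l = Suc l'" by (cases l) auto
      obtain m where m: "n l = Suc m" using n(2)[rule_format, of l] l' by (cases "n l") auto
      have "\<forall>i\<in>{1..l'}. n i < n l" using n(1) l' by (auto simp: strict_mono_on_def)
      then have "?s n a l' \<in> R m"
        using n m l' by (intro prefix) (auto simp: strict_mono_on_def)
      then show "D (?s n a l)"
        using RD[of "?s n a l'" m "a l"] n(2)[rule_format, of l] m l' by (simp only: s_Suc) auto
    qed
  qed
qed

subsection \<open>Index words\<close>

lemma word_seqs_less:
  assumes w: "w \<in> word_seqs \<alpha> \<upsilon> k" and mn: "1 \<le> m" "m < n" and "i \<in> dom (w m)" "j \<in> dom (w n)"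
  shows "i < j"
  using mn(2) assms(5)
proof (induction n arbitrary: j rule: less_induct)
  case (less n)
  then obtain n' where n': "n = Suc n'" by (cases n) auto
  have fin: "finite (dom (w l)) \<and> dom (w l) \<noteq> {}" if "l \<ge> 1" for l
    using w that by (simp add: word_seqs_def var_words_def)
  have "n' \<ge> 1" using n' less.prems mn by simp
  then have "word_less (w n') (w n)" using w n' by (simp add: word_seqs_def)
  then have *: "b < j" if "b \<in> dom (w n')" for b
    using fin[of n'] fin[of n] \<open>n' \<ge> 1\<close> n' less.prems that unfolding word_less_def
    by (meson Max_ge Min_le le_less_trans le_SucI less_le_trans)
  show ?case
  proof (cases "m = n'")
    case False
    then have "m < n'" using n' less.prems by simp
    obtain b where b: "b \<in> dom (w n')" using fin[OF \<open>n' \<ge> 1\<close>] by blast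
    show ?thesis using less.IH[of n' b] \<open>m < n'\<close> n' b *[OF b] by simp
  qed (use * assms(4) in blast)
qed

text \<open>The domains in a word sequence are pairwise disjoint, so at a covered position the
  choice is unique.\<close>

definition block :: "(nat \<Rightarrow> 'a lword) \<Rightarrow> nat \<Rightarrow> nat" where
  "block w i = (SOME n. n \<ge> 1 \<and> i \<in> dom (w n))"

text \<open>An index word \<open>x\<close>, a located word over the alphabet \<open>1, 2, \<dots>\<close> with variable \<open>0\<close>, encodes the
  product of the words \<open>T\<^bsub>x(n)\<^esub>(w\<^sub>n)\<close> over \<open>n \<in> dom x\<close>. At a position
  \<open>i\<close> covered by no \<open>w\<^sub>n\<close> the block is arbitrary, but \<open>w\<close> is undefined at \<open>i\<close> in every block
  \<open>n \<ge> 1\<close>, so the result is \<open>None\<close> as long as \<open>dom x \<subseteq> {1..}\<close>.\<close>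

definition realise ::
    "(nat \<Rightarrow> 'a) \<Rightarrow> 'a \<Rightarrow> (nat \<Rightarrow> nat) \<Rightarrow> (nat \<Rightarrow> 'a lword) \<Rightarrow> nat lword \<Rightarrow> 'a lword" where
  "realise \<alpha> \<upsilon> k w x i =
    (case x (block w i) of None \<Rightarrow> None | Some p \<Rightarrow> subst \<alpha> \<upsilon> k p (w (block w i)) i)"

locale located_words =
  fixes \<alpha> :: "nat \<Rightarrow> 'a" and \<upsilon> :: 'a and k :: "nat \<Rightarrow> nat" and w :: "nat \<Rightarrow> 'a lword"
  assumes \<upsilon>: "\<upsilon> \<notin> \<alpha> ` {1..}"
    and k_pos: "\<And>n. n \<ge> 1 \<Longrightarrow> k n \<ge> 1"
    and k_mono: "mono_on {1..} k"
    and w: "w \<in> word_seqs \<alpha> \<upsilon> k"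
begin

abbreviation "\<Phi> \<equiv> realise \<alpha> \<upsilon> k w"

lemma block_eq:
  assumes "n \<ge> 1" "i \<in> dom (w n)"
  shows "block w i = n"
  unfolding block_def
proof (rule some_equality)
  show "m = n" if "m \<ge> 1 \<and> i \<in> dom (w m)" for m
    using word_seqs_less[OF w, of m n i i] word_seqs_less[OF w, of n m i i] assms that
    by (metis less_irrefl linorder_neqE_nat)
qed (use assms in simp)

lemma realise_eq:
  assumes "n \<ge> 1" "i \<in> dom (w n)" "x n = Some p"
  shows "\<Phi> x i = subst \<alpha> \<upsilon> k p (w n) i"
  using assms block_eq[OF assms(1,2)] by (simp add: realise_def)

lemma dom_realise:
  assumes "dom x \<subseteq> {1..}"
  shows "dom (\<Phi> x) = (\<Union>n\<in>dom x. dom (w n))"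
proof (intro equalityI subsetI)
  fix i assume "i \<in> dom (\<Phi> x)"
  then obtain p where p: "x (block w i) = Some p" "subst \<alpha> \<upsilon> k p (w (block w i)) i \<noteq> None"
    by (auto simp: realise_def split: option.splits)
  then have "i \<in> dom (w (block w i))" by (simp add: subst_eq_None_iff domIff)
  then show "i \<in> (\<Union>n\<in>dom x. dom (w n))" using p(1) by blast
next
  fix i assume "i \<in> (\<Union>n\<in>dom x. dom (w n))"
  then obtain n p where "n \<ge> 1" "i \<in> dom (w n)" "x n = Some p" using assms by auto
  then show "i \<in> dom (\<Phi> x)" using realise_eq[of n i x p] by (simp add: subst_eq_None_iff domIff)
qed

lemma realise_empty [simp]: "\<Phi> Map.empty = Map.empty"
  by (simp add: realise_def fun_eq_iff)

text \<open>Substitution keeps domains, so on each block \<open>y\<close> overrides \<open>x\<close>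
  after realisation exactly when it does so as an index word.\<close>

lemma realise_map_add: "\<Phi> (x ++ y) = \<Phi> x ++ \<Phi> y"
proof
  fix i
  show "\<Phi> (x ++ y) i = (\<Phi> x ++ \<Phi> y) i"
    by (cases "x (block w i)"; cases "y (block w i)"; cases "w (block w i) i")
      (auto simp: realise_def map_add_def subst_eq_None_iff subst_def)
qed

lemma realise_singleton:
  assumes "n \<ge> 1"
  shows "\<Phi> [n \<mapsto> p] = subst \<alpha> \<upsilon> k p (w n)"
proof
  fix i
  show "\<Phi> [n \<mapsto> p] i = subst \<alpha> \<upsilon> k p (w n) i"
  proof (cases "i \<in> dom (w n)")
    case True
    then show ?thesis using assms realise_eq by simp
  next
    case False
    then have "\<Phi> [n \<mapsto> p] i = None" by (auto simp: realise_def subst_eq_None_iff domIff)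
    then show ?thesis using False subst_eq_None_iff by (metis domIff)
  qed
qed

text \<open>The flag \<open>v\<close> tells whether the letter 0 may occur in \<open>x\<close>, so
  one statement serves constant words (\<open>False\<close>) and variable words
  (\<open>True\<close>).\<close>

lemma realise_letter:
  assumes "dom x \<subseteq> {1..}" "\<And>n p. x n = Some p \<Longrightarrow> p \<noteq> 0 \<or> v" "\<Phi> x i = Some a"
  shows "i \<ge> 1 \<and> (a \<in> \<alpha> ` {1..k i} \<or> v \<and> a = \<upsilon>)"
proof -
  obtain n where n: "n \<in> dom x" "i \<in> dom (w n)"
    using assms(3) domI[of "\<Phi> x"] unfolding dom_realise[OF assms(1)] by blast
  then obtain p where p: "x n = Some p" by auto
  have "n \<ge> 1" using n assms(1) by auto
  then have wn: "w n \<in> var_words \<alpha> \<upsilon> k" using w by (simp add: word_seqs_def)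
  have a: "a = the (subst \<alpha> \<upsilon> k p (w n) i)"
    using realise_eq[of n i x p] \<open>n \<ge> 1\<close> n p assms(3) by (metis option.sel)
  have "i \<ge> 1" using wn n by (auto simp: var_words_def)
  moreover have "a \<in> \<alpha> ` {1..k i} \<or> v \<and> a = \<upsilon>"
  proof (cases "p = 0")
    case True
    then show ?thesis using a wn n assms(2)[OF p] by (auto simp: var_words_def)
  next
    case False
    then have "subst \<alpha> \<upsilon> k p (w n) \<in> const_words \<alpha> k"
      using subst_var_words[OF _ wn] k_pos by simp
    then show ?thesis using a n by (simp add: const_words_def)
  qed
  ultimately show ?thesis ..
qed

lemma finite_realise:
  assumes "finite (dom x)" "dom x \<noteq> {}" "dom x \<subseteq> {1..}"
  shows "finite (dom (\<Phi> x))" "dom (\<Phi> x) \<noteq> {}"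
proof -
  have "finite (dom (w n)) \<and> dom (w n) \<noteq> {}" if "n \<ge> 1" for n
    using w that by (simp add: word_seqs_def var_words_def)
  then show "finite (dom (\<Phi> x))" "dom (\<Phi> x) \<noteq> {}"
    unfolding dom_realise[OF assms(3)] using assms by blast+
qed

lemma realise_const_words:
  assumes "x \<in> const_words id k"
  shows "\<Phi> x \<in> const_words \<alpha> k"
proof -
  have x: "finite (dom x)" "dom x \<noteq> {}" "dom x \<subseteq> {1..}" "x n = Some p \<Longrightarrow> p \<noteq> 0 \<or> False" for n p
    using assms by (force simp: const_words_def)+
  show ?thesis
    using finite_realise[OF x(1-3)] realise_letter[OF x(3,4)]
    by (auto simp: const_words_def)
qed

lemma realise_var_words:
  assumes "x \<in> var_words id 0 k"
  shows "\<Phi> x \<in> var_words \<alpha> \<upsilon> k"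
proof -
  have x: "finite (dom x)" "dom x \<noteq> {}" "dom x \<subseteq> {1..}" and "\<exists>n\<in>dom x. x n = Some 0"
    using assms by (auto simp: var_words_def)
  then obtain n where n: "n \<ge> 1" "x n = Some 0" by auto
  moreover obtain i where "w n i = Some \<upsilon>"
    using w n(1) by (auto simp: word_seqs_def var_words_def)
  ultimately have "\<exists>i\<in>dom (\<Phi> x). \<Phi> x i = Some \<upsilon>"
    using realise_eq[of n i x 0] by (intro bexI[of _ i]) auto
  moreover have "i \<ge> 1 \<and> the (\<Phi> x i) \<in> insert \<upsilon> (\<alpha> ` {1..k i})" if "i \<in> dom (\<Phi> x)" for i
    using realise_letter[OF x(3), of True i "the (\<Phi> x i)"] that by auto
  ultimately show ?thesis
    using finite_realise[OF x] unfolding var_words_def mem_Collect_eq by auto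
qed

text \<open>The bound \<open>p \<le> k n\<close> makes the index word receive \<open>p\<close>
  itself and not the truncation \<open>k n\<close>. A block with letter 0 then becomes the
  \<open>p\<close>-instance of \<open>w n\<close> on both sides; any other letter has already made
  its block constant.\<close>

lemma realise_subst:
  assumes "dom x \<subseteq> {1..}" "\<And>n. n \<in> dom x \<Longrightarrow> p \<le> k n"
  shows "\<Phi> (subst id 0 k p x) = subst \<alpha> \<upsilon> k p (\<Phi> x)"
proof
  fix i
  define n where "n = block w i"
  show "\<Phi> (subst id 0 k p x) i = subst \<alpha> \<upsilon> k p (\<Phi> x) i"
  proof (cases "p = 0 \<or> x n = None")
    case True
    then show ?thesis by (auto simp: realise_def subst_def n_def)
  next
    case False
    then obtain q where q: "x n = Some q" and p: "p \<noteq> 0" by auto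
    then have n: "n \<ge> 1" "p \<le> k n" using assms by auto
    then have wn: "w n \<in> var_words \<alpha> \<upsilon> k" using w by (simp add: word_seqs_def)
    have L: "\<Phi> (subst id 0 k p x) i = subst \<alpha> \<upsilon> k (if q = 0 then p else q) (w n) i"
      using q n p by (simp add: realise_def n_def[symmetric] subst_def[of id])
    have R: "subst \<alpha> \<upsilon> k p (\<Phi> x) i = subst \<alpha> \<upsilon> k p (subst \<alpha> \<upsilon> k q (w n)) i"
      using q p by (simp add: realise_def n_def[symmetric] subst_def[of \<alpha> \<upsilon> k p])
    show ?thesis
    proof (cases "q = 0")
      case False
      then have "subst \<alpha> \<upsilon> k q (w n) \<in> const_words \<alpha> k"
        using subst_var_words[OF _ wn] k_pos by simp
      from subst_const_words[OF \<upsilon> this, of p] show ?thesis using L R False by simp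
    qed (use L R in simp)
  qed
qed

text \<open>Splitting \<open>x\<close> into its letters by increasing position turns each letter
  into an instance of one term of \<open>w\<close>; an occurrence of 0 supplies the unsubstituted
  factor.\<close>

lemma realise_EV:
  assumes "x \<in> var_words id 0 k"
  shows "\<Phi> x \<in> EV \<alpha> \<upsilon> k w"
proof -
  have x: "finite (dom x)" "dom x \<noteq> {}" "dom x \<subseteq> {1..}" "\<exists>n\<in>dom x. x n = Some 0"
    and letters: "\<forall>n\<in>dom x. the (x n) \<in> insert 0 (id ` {1..k n})"
    using assms by (simp_all add: var_words_def)
  have x_le: "the (x n) \<le> k n" if "n \<in> dom x" for n
    using bspec[OF letters that] by auto
  define ns where "ns = sorted_list_of_set (dom x)"
  define n where "n i = ns ! (i - 1)" for i
  define l where "l = length ns"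
  have ns: "set ns = dom x" "sorted_wrt (<) ns" using x(1) by (simp_all add: ns_def)
  have "ns \<noteq> []" using ns(1) x(2) by fastforce
  have n_dom: "n i \<in> dom x" if "i \<in> {1..l}" for i
  proof -
    have "i - 1 < length ns" using that by (auto simp: l_def)
    then show ?thesis using ns(1) nth_mem unfolding n_def by blast
  qed
  have "\<Phi> x = \<Phi> (star_list (map (\<lambda>n. [n \<mapsto> the (x n)]) ns))"
  proof -
    have "x |` dom x = x" by (auto simp: restrict_map_def fun_eq_iff domIff)
    then show ?thesis using star_list_singletons[of ns x] ns(1) by simp
  qed
  also have "\<dots> = star_list (map \<Phi> (map (\<lambda>n. [n \<mapsto> the (x n)]) ns))"
    by (rule star_list_hom) (simp_all add: realise_map_add)
  also have "map \<Phi> (map (\<lambda>n. [n \<mapsto> the (x n)]) ns) = map (\<lambda>n. subst \<alpha> \<upsilon> k (the (x n)) (w n)) ns"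
    using realise_singleton x(3) ns(1) by auto
  also have "\<dots> = map (\<lambda>i. subst \<alpha> \<upsilon> k (the (x (n i))) (w (n i))) [1..<Suc l]"
    by (rule nth_equalityI) (simp_all add: l_def n_def nth_append del: upt_Suc)
  finally have eq: "\<Phi> x = star_list \<dots>" .
  have "l \<ge> 1" using \<open>ns \<noteq> []\<close> by (cases ns) (auto simp: l_def)
  moreover have "strict_mono_on {1..l} n"
    using ns(2) by (auto simp: strict_mono_on_def n_def l_def sorted_wrt_iff_nth_less)
  moreover have "\<forall>i\<in>{1..l}. n i \<ge> 1 \<and> the (x (n i)) \<le> k (n i)"
    using n_dom x(3) x_le by (meson atLeast_iff subsetD)
  moreover have "\<exists>i\<in>{1..l}. the (x (n i)) = 0"
  proof -
    obtain m where m: "m \<in> set ns" "x m = Some 0" using x(4) ns(1) by auto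
    then obtain j where "j < length ns" "ns ! j = m" by (auto simp: in_set_conv_nth)
    then show ?thesis using m by (intro bexI[of _ "Suc j"]) (auto simp: n_def l_def)
  qed
  ultimately show ?thesis
    unfolding EV_def mem_Collect_eq
    by (intro exI[of _ l] exI[of _ n] exI[of _ "\<lambda>i. the (x (n i))"] conjI eq)
qed

lemma realise_word_less:
  assumes "finite (dom x)" "dom x \<noteq> {}" "dom x \<subseteq> {1..}" "finite (dom y)" "dom y \<noteq> {}" "dom y \<subseteq> {1..}"
    and "\<And>m n. m \<in> dom x \<Longrightarrow> n \<in> dom y \<Longrightarrow> m < n"
  shows "word_less (\<Phi> x) (\<Phi> y)"
proof -
  have "i < j" if "i \<in> dom (\<Phi> x)" "j \<in> dom (\<Phi> y)" for i j
  proof -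
    from that obtain m n where "m \<in> dom x" "i \<in> dom (w m)" "n \<in> dom y" "j \<in> dom (w n)"
      unfolding dom_realise[OF assms(3)] dom_realise[OF assms(6)] by blast
    moreover from this have "m < n" "m \<ge> 1" using assms(3,7) by auto
    ultimately show ?thesis using word_seqs_less[OF w] by blast
  qed
  then show ?thesis
    using finite_realise[OF assms(1-3)] finite_realise[OF assms(4-6)] by (simp add: word_less_def)
qed

end

section \<open>Separating variable from constant products, and transfer to the given words\<close>

text \<open>Every term of \<open>v\<close> contains 0, an instance loses it exactly when its
  parameter is positive, and disjoint domains exclude overwriting. This decides on which side of the
  colouring a product falls.\<close>

lemma zero_in_ran_product:
  assumes v: "v \<in> word_seqs id 0 k" and k: "\<forall>n\<ge>1. k n \<ge> 1"
    and n: "strict_mono_on {1..l} n" "\<forall>i\<in>{1..l}. n i \<ge> 1"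
  shows "0 \<in> ran (star_list (map (\<lambda>i. subst id 0 k (a i) (v (n i))) [1..<Suc l])) \<longleftrightarrow>
    (\<exists>i\<in>{1..l}. a i = 0)"
proof -
  define X where "X = (\<lambda>i. subst id 0 k (a i) (v (n i)))"
  have "dom (map X [1..<Suc l] ! i) \<inter> dom (map X [1..<Suc l] ! j) = {}"
    if "i < j" "j < length (map X [1..<Suc l])" for i j
  proof -
    have ij: "Suc i \<in> {1..l}" "Suc j \<in> {1..l}" using that by (simp_all del: upt_Suc)
    then have "n (Suc i) < n (Suc j)" "n (Suc i) \<ge> 1"
      using n \<open>i < j\<close> ij by (auto simp: strict_mono_on_def)
    then have "dom (X (Suc i)) \<inter> dom (X (Suc j)) = {}"
      using word_seqs_less[OF v, of "n (Suc i)" "n (Suc j)"] 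
      unfolding X_def dom_subst by (meson disjoint_iff less_irrefl)
    then show ?thesis using that by (simp del: upt_Suc)
  qed
  then have "ran (star_list (map X [1..<Suc l])) = (\<Union>x\<in>set (map X [1..<Suc l]). ran x)"
    by (rule ran_star_list)
  then have "ran (star_list (map X [1..<Suc l])) = (\<Union>i\<in>{1..l}. ran (X i))"
    by (simp del: upt_Suc add: atLeastLessThanSuc_atLeastAtMost)
  moreover have "0 \<in> ran (X i) \<longleftrightarrow> a i = 0" if "i \<in> {1..l}" for i
  proof -
    have vi: "v (n i) \<in> var_words id 0 k" using v n that by (simp add: word_seqs_def)
    show ?thesis
    proof (cases "a i = 0")
      case True
      then show ?thesis using vi by (auto simp: X_def var_words_def ran_def)
    next
      case False
      then have "X i \<in> const_words id k" using subst_var_words[OF k vi] by (simp add: X_def)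
      then show ?thesis using False by (force simp: const_words_def ran_def)
    qed
  qed
  ultimately have "0 \<in> ran (star_list (map X [1..<Suc l])) \<longleftrightarrow> (\<exists>i\<in>{1..l}. a i = 0)"
    by blast
  then show ?thesis by (simp only: X_def)
qed

theorem theorem1p4:
  fixes \<alpha> :: "nat \<Rightarrow> 'a" and \<upsilon> :: 'a and k :: "nat \<Rightarrow> nat"
    and w :: "nat \<Rightarrow> 'a lword" and r s :: nat
    and A C :: "nat \<Rightarrow> 'a lword set"
  assumes "inj_on \<alpha> {1..}"
    and "\<upsilon> \<notin> \<alpha> ` {1..}"
    and "\<forall>n\<ge>1. k n \<ge> 1"
    and "mono_on {1..} k"
    and "w \<in> word_seqs \<alpha> \<upsilon> k"
    and "r \<ge> 1" and "s \<ge> 1"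
    and "var_words \<alpha> \<upsilon> k = (\<Union>i\<in>{1..r}. A i)"
    and "const_words \<alpha> k = (\<Union>j\<in>{1..s}. C j)"
  shows "\<exists>u. extraction \<alpha> \<upsilon> k u w \<and>
           (\<exists>i\<^sub>0\<in>{1..r}. \<exists>j\<^sub>0\<in>{1..s}. EV \<alpha> \<upsilon> k u \<subseteq> A i\<^sub>0 \<and> E \<alpha> \<upsilon> k u \<subseteq> C j\<^sub>0)"
proof -
  interpret located_words \<alpha> \<upsilon> k w
    using assms(2-5) by unfold_locales auto
  obtain p q where
    p: "p \<in> ultrafilters_on (\<lambda>N. {x \<in> const_words id k. dom x \<subseteq> {N..}})"
    and q: "q \<in> ultrafilters_on (\<lambda>N. {x \<in> var_words id 0 k. dom x \<subseteq> {N..}})"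
    and idem: "convolution (++) p p = p" "convolution (++) q q = q"
      "convolution (++) p q = q" "convolution (++) q p = q"
    and push: "\<forall>a\<ge>1. pushforward (subst id 0 k a) q = p"
    by (rule idempotents_on_words[OF assms(3)])
  have p': "p \<in> ultrafilters" and q': "q \<in> ultrafilters"
    using p q by (simp_all add: ultrafilters_on_def)
  have pW: "p (\<lambda>x. x \<in> const_words id k)" and qV: "q (\<lambda>x. x \<in> var_words id 0 k)"
    using p q by (auto simp: ultrafilters_on_def dest: spec[of _ 0])
  \<comment> \<open>\<Phi> pulls the coverings back to index words, and an ultrafilter selects one
    member of a finite covering.\<close>
  have "q (\<lambda>x. \<exists>i\<in>{1..r}. \<Phi> x \<in> A i)"
    using realise_var_words assms(8) by (intro ultrafilter_mono[OF q', OF qV]) blast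
  then obtain i\<^sub>0 where i0: "i\<^sub>0 \<in> {1..r}" "q (\<lambda>x. \<Phi> x \<in> A i\<^sub>0)"
    by (rule ultrafilter_bex[OF q' finite_atLeastAtMost])
  have "p (\<lambda>x. \<exists>j\<in>{1..s}. \<Phi> x \<in> C j)"
    using realise_const_words assms(9) by (intro ultrafilter_mono[OF p', OF pW]) blast
  then obtain j\<^sub>0 where j0: "j\<^sub>0 \<in> {1..s}" "p (\<lambda>x. \<Phi> x \<in> C j\<^sub>0)"
    by (rule ultrafilter_bex[OF p' finite_atLeastAtMost])
  \<comment> \<open>The construction wants one predicate large for both \<open>p\<close> and
    \<open>q\<close>, hence the disjunction; the occurrence of 0 later picks the branch.\<close>
  define D where "D x \<longleftrightarrow> x \<in> var_words id 0 k \<and> \<Phi> x \<in> A i\<^sub>0 \<or> x \<in> const_words id k \<and> \<Phi> x \<in> C j\<^sub>0" for x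
  have "p (\<lambda>x. x \<in> const_words id k \<and> \<Phi> x \<in> C j\<^sub>0)"
    using pW j0 by (simp add: ultrafilter_conj[OF p'])
  then have pD: "p D" by (rule ultrafilter_mono[OF p']) (simp add: D_def)
  have "q (\<lambda>x. x \<in> var_words id 0 k \<and> \<Phi> x \<in> A i\<^sub>0)"
    using qV i0 by (simp add: ultrafilter_conj[OF q'])
  then have qD: "q D" by (rule ultrafilter_mono[OF q']) (simp add: D_def)
  obtain v where v_seq: "v \<in> word_seqs id 0 k" and v_ge: "\<forall>n\<ge>1. dom (v n) \<subseteq> {n..}"
    and vD: "\<forall>l n a. l \<ge> 1 \<longrightarrow> strict_mono_on {1..l} n \<longrightarrow> (\<forall>i\<in>{1..l}. n i \<ge> 1 \<and> a i \<le> k (n i)) \<longrightarrow>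
      D (star_list (map (\<lambda>i. subst id 0 k (a i) (v (n i))) [1..<Suc l]))"
    by (rule sequence_with_large_products[OF p' q idem push pD qD])
  have v: "v n \<in> var_words id 0 k" if "n \<ge> 1" for n
    using v_seq that by (simp add: word_seqs_def)
  then have v_dom: "finite (dom (v n))" "dom (v n) \<noteq> {}" "dom (v n) \<subseteq> {1..}" if "n \<ge> 1" for n
    using that by (simp_all add: var_words_def)
  define u where "u n = \<Phi> (v n)" for n
  have u_seq: "u \<in> word_seqs \<alpha> \<upsilon> k"
    unfolding word_seqs_def mem_Collect_eq u_def
  proof (intro allI impI conjI)
    fix n :: nat assume "n \<ge> 1"
    then show "\<Phi> (v n) \<in> var_words \<alpha> \<upsilon> k" using v realise_var_words by blast
    show "word_less (\<Phi> (v n)) (\<Phi> (v (Suc n)))"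
      using v_dom[of n] v_dom[of "Suc n"] word_seqs_less[OF v_seq, of n "Suc n"] \<open>n \<ge> 1\<close>
      by (intro realise_word_less) auto
  qed
  then have "extraction \<alpha> \<upsilon> k u w"
    using v realise_EV by (simp add: extraction_def u_def)
  let ?X = "\<lambda>l n a. star_list (map (\<lambda>i. subst id 0 k (a i) (v (n i))) [1..<Suc l])"
  have image: "star_list (map (\<lambda>i. subst \<alpha> \<upsilon> k (a i) (u (n i))) [1..<Suc l]) = \<Phi> (?X l n a)"
    if bound: "\<forall>i\<in>{1..l}. n i \<ge> 1 \<and> a i \<le> k (n i)" for l a and n :: "nat \<Rightarrow> nat"
  proof -
    have "\<Phi> (subst id 0 k (a i) (v (n i))) = subst \<alpha> \<upsilon> k (a i) (u (n i))" if "i \<in> {1..l}" for i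
      unfolding u_def
    proof (rule realise_subst)
      have ni: "n i \<ge> 1" "a i \<le> k (n i)" using bound that by auto
      show "dom (v (n i)) \<subseteq> {1..}" using v_dom ni by blast
      fix m assume "m \<in> dom (v (n i))"
      then have "n i \<le> m" using v_ge ni by auto
      \<comment> \<open>The term numbered \<open>n i\<close> lives on indices from
        \<open>n i\<close> on, where \<open>k\<close> is at least \<open>k (n i)\<close>, so an
        admissible parameter is never truncated inside it.\<close>
      then show "a i \<le> k m" using mono_onD[OF k_mono, of "n i" m] ni by simp
    qed
    then have "map (\<lambda>i. subst \<alpha> \<upsilon> k (a i) (u (n i))) [1..<Suc l] =
        map \<Phi> (map (\<lambda>i. subst id 0 k (a i) (v (n i))) [1..<Suc l])"
      by auto
    then show ?thesis using star_list_hom[of \<Phi>, OF realise_empty realise_map_add] by metis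
  qed
  have "EV \<alpha> \<upsilon> k u \<subseteq> A i\<^sub>0"
  proof
    fix y assume "y \<in> EV \<alpha> \<upsilon> k u"
    then obtain l n a where y: "y = star_list (map (\<lambda>i. subst \<alpha> \<upsilon> k (a i) (u (n i))) [1..<Suc l])"
      and l: "l \<ge> 1" "strict_mono_on {1..l} n" "\<forall>i\<in>{1..l}. n i \<ge> 1 \<and> a i \<le> k (n i)"
      and zero: "\<exists>i\<in>{1..l}. a i = 0"
      unfolding EV_def by blast
    have "0 \<in> ran (?X l n a)"
      using zero_in_ran_product[OF v_seq assms(3) l(2), of a] l(3) zero by blast
    then have "?X l n a \<notin> const_words id k" by (force simp: const_words_def ran_def)
    then show "y \<in> A i\<^sub>0" using vD l unfolding y image[OF l(3)] D_def by blast
  qed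
  moreover have "E \<alpha> \<upsilon> k u \<subseteq> C j\<^sub>0"
  proof
    fix y assume "y \<in> E \<alpha> \<upsilon> k u"
    then obtain l n a where y: "y = star_list (map (\<lambda>i. subst \<alpha> \<upsilon> k (a i) (u (n i))) [1..<Suc l])"
      and l: "l \<ge> 1" "strict_mono_on {1..l} n" "\<forall>i\<in>{1..l}. n i \<ge> 1 \<and> 1 \<le> a i \<and> a i \<le> k (n i)"
      unfolding E_def by blast
    have l': "\<forall>i\<in>{1..l}. n i \<ge> 1 \<and> a i \<le> k (n i)" using l(3) by blast
    have "0 \<notin> ran (?X l n a)"
      using zero_in_ran_product[OF v_seq assms(3) l(2), of a] l(3) by fastforce
    then have "?X l n a \<notin> var_words id 0 k" by (auto simp: var_words_def ran_def)
    then show "y \<in> C j\<^sub>0" using vD l(1,2) l' unfolding y image[OF l'] D_def by blast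
  qed
  ultimately show ?thesis
    using \<open>extraction \<alpha> \<upsilon> k u w\<close> i0(1) j0(1) by blast
qed

end
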